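(* Let $(S,\Sigma,\mu)$ be a measure space with $\mu$ a complete positive measure, and let $X$ be a Banach space over $\mathbb{F}$ ($\mathbb{R}$ or $\mathbb{C}$) whose norm is Fréchet differentiable. Then, for $1<p<\infty$, the map $[\cdot,\cdot]:L^p(\mu,X)\times L^p(\mu,X)\rightarrow\mathbb{F}$ defined by $$[f,g]=\begin{cases}\dfrac{1}{\|g\|^{p-2}}\displaystyle\int_{Z(g)^c}\|g(s)\|^{p-1}F_{g(s)}(f(s))\,d\mu(s), & g\neq 0,\\[2mm] 0, & g=0,\end{cases}$$ is a semi-inner product on $L^p(\mu,X)$.
   Context: $L^p(\mu,X)$ is the Lebesgue-Bochner space of (a.e.-equivalence classes of) strongly measurable functions $f:S\to X$ (a.e. pointwise limits of simple measurable functions) with $\|f\|=\left(\int_S\|f(s)\|^p\,d\mu(s)\right)^{1/p}<\infty$. $Z(g)=\{s\in S:g(s)=0\}$ and $Z(g)^c=S\setminus Z(g)$. The norm of $X$ is Fréchet differentiable if for every non-zero $x\in X$ there is $\phi\in X^*$ with $\lim_{h\to0}\frac{\left|\|x+h\|-\|x\|-\operatorname{Re}\phi(h)\right|}{\|h\|}=0$ (with $\operatorname{Re}\phi=\phi$ if $\mathbb{F}=\mathbb{R}$). In that case $X$ is smooth: for each non-zero $x\in X$ there is exactly one $F_x\in X^*$ with $\|F_x\|=1$ and $F_x(x)=\|x\|$; this defines $F_x$. A semi-inner product on a normed space $Y$ over $\mathbb{F}$ is a map $[\cdot,\cdot]:Y\times Y\to\mathbb{F}$ such that for all $x,y,z\in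 Y$ and $\alpha,\beta\in\mathbb{F}$: (1) $[\alpha x+\beta y,z]=\alpha[x,z]+\beta[y,z]$; (2) $[x,\alpha y]=\bar\alpha[x,y]$; (3) $|[x,y]|\le\|x\|\|y\|$; (4) $[x,x]=\|x\|^2$. *)

theory Defs
  imports "HOL-Analysis.Analysis"
begin

text \<open>The scalar field, uniformly for \<open>\<real>\<close> and \<open>\<complex>\<close>. By the Gelfand-Mazur theorem the two
  instances below are, up to isomorphism, the only models.\<close>

class real_or_complex = real_normed_field + banach + second_countable_topology +
  fixes conjg :: "'a \<Rightarrow> 'a" and re :: "'a \<Rightarrow> real"
  assumes conjg_add: "conjg (a + b) = conjg a + conjg b"
    and conjg_mult: "conjg (a * b) = conjg a * conjg b"
    and mult_conjg: "a * conjg a = (norm a)\<^sup>2 *\<^sub>R 1"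
    and add_conjg: "a + conjg a = (2 * re a) *\<^sub>R 1"

instantiation real :: real_or_complex
begin

definition conjg_real :: "real \<Rightarrow> real" where "conjg_real a = a"

definition re_real :: "real \<Rightarrow> real" where "re_real a = a"

instance
  by standard (auto simp: conjg_real_def re_real_def power2_eq_square)

end

instantiation complex :: real_or_complex
begin

definition conjg_complex :: "complex \<Rightarrow> complex" where "conjg_complex a = cnj a"

definition re_complex :: "complex \<Rightarrow> real" where "re_complex a = Re a"

instance
proof
  fix a b :: complex
  show "conjg (a + b) = conjg a + conjg b" "conjg (a * b) = conjg a * conjg b"
    by (simp_all add: conjg_complex_def)
  show "a * conjg a = (norm a)\<^sup>2 *\<^sub>R 1"
    by (metis conjg_complex_def complex_norm_square scaleR_conv_of_real mult.right_neutral)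
  show "a + conjg a = (2 * re a) *\<^sub>R 1"
    by (simp add: conjg_complex_def re_complex_def complex_eq_iff)
qed

end

text \<open>A Banach space over the scalar field: the type class \<open>banach\<close> supplies the complete norm and
  the underlying real vector space, \<open>smul\<close> the scalar multiplication extending that of the reals.\<close>

locale banach_over = vector_space smul
  for smul :: "'f::real_or_complex \<Rightarrow> 'x::banach \<Rightarrow> 'x" +
  assumes norm_scale: "norm (smul a x) = norm a * norm x"
    and scale_of_real: "smul (of_real r) x = r *\<^sub>R x"

definition dual :: "('f::real_or_complex \<Rightarrow> 'x::banach \<Rightarrow> 'x) \<Rightarrow> ('x \<Rightarrow> 'f) set" where
  "dual smul = {\<phi>. bounded_linear \<phi> \<and> (\<forall>a x. \<phi> (smul a x) = a * \<phi> x)}"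

definition frechet_differentiable_norm :: "('f::real_or_complex \<Rightarrow> 'x::banach \<Rightarrow> 'x) \<Rightarrow> bool" where
  "frechet_differentiable_norm smul \<longleftrightarrow>
    (\<forall>x. x \<noteq> 0 \<longrightarrow> (\<exists>\<phi>\<in>dual smul.
      ((\<lambda>h. \<bar>norm (x + h) - norm x - re (\<phi> h)\<bar> / norm h) \<longlongrightarrow> 0) (at 0)))"

text \<open>The functional \<open>F\<^sub>x\<close>; meaningful only for \<open>x \<noteq> 0\<close> in a smooth space.\<close>

definition support_functional ::
    "('f::real_or_complex \<Rightarrow> 'x::banach \<Rightarrow> 'x) \<Rightarrow> 'x \<Rightarrow> 'x \<Rightarrow> 'f" where
  "support_functional smul x =
    (THE \<phi>. \<phi> \<in> dual smul \<and> onorm \<phi> = 1 \<and> \<phi> x = of_real (norm x))"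

text \<open>The library notions of Bochner measurability and integrability require a second countable
  codomain, which is too restrictive here.\<close>

definition strongly_measurable :: "'s measure \<Rightarrow> ('s \<Rightarrow> 'x::banach) \<Rightarrow> bool" where
  "strongly_measurable M f \<longleftrightarrow>
    (\<exists>u. (\<forall>i::nat. simple_function M (u i)) \<and> (AE s in M. (\<lambda>i. u i s) \<longlonglongrightarrow> f s))"

definition Lp_fun :: "'s measure \<Rightarrow> real \<Rightarrow> ('s \<Rightarrow> 'x::banach) set" where
  "Lp_fun M p =
    {f. strongly_measurable M f \<and> (\<integral>\<^sup>+ s. ennreal (norm (f s) powr p) \<partial>M) < \<infinity>}"

definition Lp_fun_norm :: "'s measure \<Rightarrow> real \<Rightarrow> ('s \<Rightarrow> 'x::banach) \<Rightarrow> real" where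
  "Lp_fun_norm M p f = enn2real (\<integral>\<^sup>+ s. ennreal (norm (f s) powr p) \<partial>M) powr (1 / p)"

definition Lp_rel :: "'s measure \<Rightarrow> real \<Rightarrow> (('s \<Rightarrow> 'x::banach) \<times> ('s \<Rightarrow> 'x)) set" where
  "Lp_rel M p = {(f, g). f \<in> Lp_fun M p \<and> g \<in> Lp_fun M p \<and> (AE s in M. f s = g s)}"

definition Lp_class :: "'s measure \<Rightarrow> real \<Rightarrow> ('s \<Rightarrow> 'x::banach) \<Rightarrow> ('s \<Rightarrow> 'x) set" where
  "Lp_class M p f = Lp_rel M p `` {f}"

definition Lp :: "'s measure \<Rightarrow> real \<Rightarrow> ('s \<Rightarrow> 'x::banach) set set" where
  "Lp M p = Lp_fun M p // Lp_rel M p"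

definition Lp_rep :: "('s \<Rightarrow> 'x) set \<Rightarrow> 's \<Rightarrow> 'x" where
  "Lp_rep A = (SOME f. f \<in> A)"

definition Lp_add ::
    "'s measure \<Rightarrow> real \<Rightarrow> ('s \<Rightarrow> 'x::banach) set \<Rightarrow> ('s \<Rightarrow> 'x) set \<Rightarrow> ('s \<Rightarrow> 'x) set" where
  "Lp_add M p A B = Lp_class M p (\<lambda>s. Lp_rep A s + Lp_rep B s)"

definition Lp_scale ::
    "('f::real_or_complex \<Rightarrow> 'x::banach \<Rightarrow> 'x) \<Rightarrow> 's measure \<Rightarrow> real \<Rightarrow>
      'f \<Rightarrow> ('s \<Rightarrow> 'x) set \<Rightarrow> ('s \<Rightarrow> 'x) set" where
  "Lp_scale smul M p a A = Lp_class M p (\<lambda>s. smul a (Lp_rep A s))"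

definition Lp_norm :: "'s measure \<Rightarrow> real \<Rightarrow> ('s \<Rightarrow> 'x::banach) set \<Rightarrow> real" where
  "Lp_norm M p A = Lp_fun_norm M p (Lp_rep A)"

definition nonzero_set :: "'s measure \<Rightarrow> ('s \<Rightarrow> 'x::banach) \<Rightarrow> 's set" where
  "nonzero_set M g = {s \<in> space M. g s \<noteq> 0}"

definition sip_integrand ::
    "('f::real_or_complex \<Rightarrow> 'x::banach \<Rightarrow> 'x) \<Rightarrow> real \<Rightarrow>
      ('s \<Rightarrow> 'x) \<Rightarrow> ('s \<Rightarrow> 'x) \<Rightarrow> 's \<Rightarrow> 'f" where
  "sip_integrand smul p f g s =
    of_real (norm (g s) powr (p - 1)) * support_functional smul (g s) (f s)"

text \<open>The bracket on functions; \<open>g = 0\<close> in \<open>L\<^sup>p\<close> means that \<open>g\<close> vanishes almost everywhere.\<close>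

definition sip_fun ::
    "('f::real_or_complex \<Rightarrow> 'x::banach \<Rightarrow> 'x) \<Rightarrow> 's measure \<Rightarrow> real \<Rightarrow>
      ('s \<Rightarrow> 'x) \<Rightarrow> ('s \<Rightarrow> 'x) \<Rightarrow> 'f" where
  "sip_fun smul M p f g =
    (if AE s in M. g s = 0 then 0
     else of_real (1 / Lp_fun_norm M p g powr (p - 2)) *
       set_lebesgue_integral M (nonzero_set M g) (sip_integrand smul p f g))"

definition Lp_sip ::
    "('f::real_or_complex \<Rightarrow> 'x::banach \<Rightarrow> 'x) \<Rightarrow> 's measure \<Rightarrow> real \<Rightarrow>
      ('s \<Rightarrow> 'x) set \<Rightarrow> ('s \<Rightarrow> 'x) set \<Rightarrow> 'f" where
  "Lp_sip smul M p A B = sip_fun smul M p (Lp_rep A) (Lp_rep B)"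

text \<open>Semi-inner products on a normed space given by a carrier set with its operations; the carrier
  is explicit because \<open>L\<^sup>p\<close> depends on a measure and hence is not a type.\<close>

definition semi_inner_product_on ::
    "'y set \<Rightarrow> ('y \<Rightarrow> 'y \<Rightarrow> 'y) \<Rightarrow> ('f::real_or_complex \<Rightarrow> 'y \<Rightarrow> 'y) \<Rightarrow> ('y \<Rightarrow> real) \<Rightarrow>
      ('y \<Rightarrow> 'y \<Rightarrow> 'f) \<Rightarrow> bool" where
  "semi_inner_product_on Y add smul nrm ip \<longleftrightarrow>
    (\<forall>x\<in>Y. \<forall>y\<in>Y. \<forall>z\<in>Y. \<forall>\<alpha> \<beta>.
      ip (add (smul \<alpha> x) (smul \<beta> y)) z = \<alpha> * ip x z + \<beta> * ip y z) \<and>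
    (\<forall>x\<in>Y. \<forall>y\<in>Y. \<forall>\<alpha>. ip x (smul \<alpha> y) = conjg \<alpha> * ip x y) \<and>
    (\<forall>x\<in>Y. \<forall>y\<in>Y. norm (ip x y) \<le> nrm x * nrm y) \<and>
    (\<forall>x\<in>Y. ip x x = of_real ((nrm x)\<^sup>2))"

end

theory Submission
  imports Defs
begin

text \<open>Fix a non-zero \<open>x\<close>. The real part of the derivative of the norm at \<open>x\<close> is the limit of the
  difference quotients \<open>(\<parallel>x + t h\<parallel> - \<parallel>x\<parallel>) / t\<close>, and every functional of norm one with value
  \<open>\<parallel>x\<parallel>\<close> at \<open>x\<close> has its real part below these quotients for \<open>t > 0\<close> and above them for \<open>t < 0\<close>. So the derivative is the
  support functional \<open>F\<^sub>x\<close> (\<open>norm_derivative_norming\<close>, \<open>norming_unique\<close>). From uniqueness,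
  \<open>F\<^bsub>ax\<^esub> = (conjg a / |a|) F\<^sub>x\<close>. Because the quotients converge uniformly in \<open>h\<close> on bounded sets, the same
  comparison made at a nearby point shows that \<open>x \<mapsto> F\<^sub>x\<close> is norm continuous away from \<open>0\<close>
  (\<open>norming_close_to_derivative\<close>, after Smulian).

  Continuity makes the integral meaningful. If simple functions \<open>u\<^sub>i\<close> and \<open>v\<^sub>i\<close> converge to \<open>f\<close> and \<open>g\<close>,
  then the scalar simple functions \<open>s \<mapsto> \<parallel>v\<^sub>i s\<parallel> powr (p - 1) * F\<^bsub>v\<^sub>i s\<^esub> (u\<^sub>i s)\<close> converge to the integrand
  almost everywhere on the set where \<open>g\<close> does not vanish, and completeness of the measure turns almost
  everywhere limits into measurable functions (\<open>borel_measurable_sip_integrand\<close>). The integrand is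
  dominated by \<open>\<parallel>f\<parallel> \<parallel>g\<parallel> powr (p - 1)\<close>, so Hoelder's inequality gives integrability and, after
  division by \<open>\<parallel>g\<parallel> powr (p - 2)\<close>, the Cauchy-Schwarz inequality of the bracket.

  The other laws hold pointwise under the integral: linearity is that of \<open>F\<^bsub>g s\<^esub>\<close>, conjugate
  homogeneity follows from the formula for \<open>F\<^bsub>ax\<^esub>\<close> since the powers of \<open>|a|\<close> cancel, and
  \<open>[g, g] = \<parallel>g\<parallel>\<^sup>2\<close> comes from \<open>F\<^sub>x x = \<parallel>x\<parallel>\<close>. All expressions involved are insensitive to changes on
  null sets, which carries the laws from functions to classes.\<close>

section \<open>Scalars\<close>

lemma conjg_zero: "conjg (0::'a::real_or_complex) = 0"
  using conjg_add[of "0::'a" 0] by simp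

lemma mult_conjg_of_real: "a * conjg a = of_real ((norm a)\<^sup>2)"
  by (simp add: mult_conjg of_real_def)

lemma add_conjg_of_real: "a + conjg a = of_real (2 * re a)"
  by (simp add: add_conjg of_real_def)

lemma norm_conjg: "norm (conjg a) = norm a"
proof (cases "a = 0")
  case False
  have "norm a * norm (conjg a) = norm (a * conjg a)"
    by (simp add: norm_mult)
  also have "\<dots> = norm a * norm a"
    by (simp add: mult_conjg power2_eq_square)
  finally show ?thesis using False by simp
qed (simp add: conjg_zero)

lemma conjg_of_real: "conjg (of_real r) = (of_real r :: 'a::real_or_complex)"
proof (cases "r = 0")
  case False
  have "of_real r * conjg (of_real r :: 'a) = of_real r * of_real r"
    by (simp add: mult_conjg_of_real power2_eq_square)
  then show ?thesis using False by simp
qed (simp add: conjg_zero)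

lemma re_of_real: "re (of_real r :: 'a::real_or_complex) = r"
proof -
  have "of_real (2 * r) = (of_real (2 * re (of_real r :: 'a)) :: 'a)"
    using add_conjg_of_real[of "of_real r :: 'a"] by (simp add: conjg_of_real)
  then show ?thesis by (subst (asm) of_real_eq_iff) simp
qed

lemma re_add: "re (a + b) = re a + re b" for a b :: "'a::real_or_complex"
proof -
  have "(of_real (2 * re (a + b)) :: 'a) = (a + conjg a) + (b + conjg b)"
    by (simp only: add_conjg_of_real[symmetric] conjg_add) (simp add: algebra_simps)
  also have "\<dots> = of_real (2 * (re a + re b))"
    by (simp only: add_conjg_of_real) (simp add: algebra_simps)
  finally show ?thesis by (subst (asm) of_real_eq_iff) simp
qed

lemma re_diff: "re (a - b) = re a - re b" for a b :: "'a::real_or_complex"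
  using re_add[of "a - b" b] by simp

lemma abs_re_le_norm: "\<bar>re a\<bar> \<le> norm a"
proof -
  have "norm (a + conjg a) \<le> norm a + norm a"
    by (metis norm_conjg norm_triangle_ineq)
  then show ?thesis by (simp only: add_conjg_of_real norm_of_real)
qed

lemma re_of_real_mult: "re (of_real r * a) = r * re a" for a :: "'a::real_or_complex"
proof -
  have "(of_real (2 * re (of_real r * a)) :: 'a) = of_real r * (a + conjg a)"
    by (simp only: add_conjg_of_real[symmetric] conjg_mult conjg_of_real)
      (simp add: algebra_simps)
  also have "\<dots> = of_real (2 * (r * re a))"
    by (simp only: add_conjg_of_real) simp
  finally show ?thesis by (subst (asm) of_real_eq_iff) simp
qed

text \<open>Expand \<open>|z - r|\<^sup>2 = |z|\<^sup>2 - r (z + conjg z) + r\<^sup>2\<close> at \<open>r = re z\<close>: it is at most \<open>0\<close>.\<close>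

lemma eq_of_real_if_norm_le_re:
  fixes z :: "'a::real_or_complex"
  assumes "norm z \<le> re z"
  shows "z = of_real (re z)"
proof -
  let ?r = "re z"
  have "conjg (z - of_real ?r) + conjg (of_real ?r) = conjg z"
    by (simp flip: conjg_add)
  then have c: "conjg (z - of_real ?r) = conjg z - of_real ?r"
    by (simp add: conjg_of_real eq_diff_eq)
  have "(of_real ((norm (z - of_real ?r))\<^sup>2) :: 'a) = z * conjg z - of_real ?r * (z + conjg z) + of_real (?r\<^sup>2)"
    by (simp only: mult_conjg_of_real[symmetric] c) (simp add: algebra_simps power2_eq_square)
  also have "\<dots> = of_real ((norm z)\<^sup>2 - ?r\<^sup>2)"
    by (simp only: mult_conjg_of_real add_conjg_of_real)
      (simp add: algebra_simps power2_eq_square)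
  finally have "(norm (z - of_real ?r))\<^sup>2 = (norm z)\<^sup>2 - ?r\<^sup>2"
    by (subst (asm) of_real_eq_iff)
  moreover have "(norm z)\<^sup>2 \<le> ?r\<^sup>2"
    using assms by (intro power_mono) auto
  ultimately have "(norm (z - of_real ?r))\<^sup>2 \<le> 0" by simp
  then show ?thesis by simp
qed

lemma le_if_le_add_epsilon_mult:
  fixes a b c :: real
  assumes "0 \<le> b" and le: "\<And>\<epsilon>. 0 < \<epsilon> \<Longrightarrow> a \<le> c + \<epsilon> * b"
  shows "a \<le> c"
proof (rule field_le_epsilon)
  fix e :: real assume "0 < e"
  have "0 < b + 1" using \<open>0 \<le> b\<close> by simp
  then have "e / (b + 1) * b \<le> e"
    using \<open>0 < e\<close> by (simp add: field_simps)
  moreover have "a \<le> c + e / (b + 1) * b"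
    using \<open>0 < e\<close> \<open>0 < b + 1\<close> by (intro le) simp
  ultimately show "a \<le> c + e" by simp
qed

section \<open>Support functionals\<close>

context banach_over
begin

lemma dual_bounded_linear: "\<phi> \<in> dual smul \<Longrightarrow> bounded_linear \<phi>"
  by (simp add: dual_def)

lemma dual_smul: "\<phi> \<in> dual smul \<Longrightarrow> \<phi> (smul a x) = a * \<phi> x"
  by (simp add: dual_def)

lemma dual_scaleR: "\<phi> \<in> dual smul \<Longrightarrow> \<phi> (r *\<^sub>R x) = of_real r * \<phi> x"
  by (metis dual_smul scale_of_real)

lemma dual_diff: "\<phi> \<in> dual smul \<Longrightarrow> \<psi> \<in> dual smul \<Longrightarrow> (\<lambda>h. \<phi> h - \<psi> h) \<in> dual smul"
  by (auto simp: dual_def bounded_linear_sub right_diff_distrib)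

lemma dual_mult: "\<phi> \<in> dual smul \<Longrightarrow> (\<lambda>h. c * \<phi> h) \<in> dual smul"
  by (auto simp: dual_def bounded_linear_const_mult)

text \<open>Multiplying \<open>h\<close> by a suitable scalar makes \<open>\<omega> h\<close> real and positive, so a bound on the real
  part over a single sphere already bounds the norm of the functional.\<close>

lemma dual_norm_leI:
  assumes \<omega>: "\<omega> \<in> dual smul" and "0 < \<delta>" "0 \<le> C"
    and le: "\<And>k. norm k = \<delta> \<Longrightarrow> re (\<omega> k) \<le> C * \<delta>"
  shows "norm (\<omega> h) \<le> C * norm h"
proof (cases "\<omega> h = 0")
  case False
  interpret bounded_linear \<omega> using \<omega> by (rule dual_bounded_linear)
  have h: "norm h > 0" using False zero by auto
  define a where "a = of_real (\<delta> / (norm (\<omega> h) * norm h)) * conjg (\<omega> h)"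
  have "norm (smul a h) = \<delta>"
    using False h \<open>0 < \<delta>\<close> by (simp add: norm_scale a_def norm_mult norm_conjg norm_divide)
  moreover have "\<omega> (smul a h) = of_real (norm (\<omega> h) * \<delta> / norm h)"
  proof -
    have "\<omega> (smul a h) = of_real (\<delta> / (norm (\<omega> h) * norm h)) * (\<omega> h * conjg (\<omega> h))"
      using \<omega> by (simp add: dual_smul a_def)
    also have "\<dots> = of_real (\<delta> / (norm (\<omega> h) * norm h) * (norm (\<omega> h))\<^sup>2)"
      by (simp only: mult_conjg_of_real of_real_mult)
    finally show ?thesis
      using False by (simp add: power2_eq_square)
  qed
  ultimately have "norm (\<omega> h) * \<delta> / norm h \<le> C * \<delta>"
    using le[of "smul a h"] by (simp only: re_of_real)
  then show ?thesis
    using \<open>0 < \<delta>\<close> h by (simp add: field_simps)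
qed (use \<open>0 \<le> C\<close> in simp)

text \<open>The bound \<open>\<parallel>\<phi> h\<parallel> \<le> \<parallel>h\<parallel>\<close> is easier to verify for derivatives of the norm than \<open>onorm \<phi> = 1\<close>,
  and for \<open>x \<noteq> 0\<close> the value at \<open>x\<close> makes the two equivalent.\<close>

definition norming :: "('x \<Rightarrow> 'f) \<Rightarrow> 'x \<Rightarrow> bool" where
  "norming \<phi> x \<longleftrightarrow> \<phi> \<in> dual smul \<and> (\<forall>h. norm (\<phi> h) \<le> norm h) \<and> \<phi> x = of_real (norm x)"

lemma norming_iff_onorm:
  assumes "x \<noteq> 0"
  shows "norming \<phi> x \<longleftrightarrow> \<phi> \<in> dual smul \<and> onorm \<phi> = 1 \<and> \<phi> x = of_real (norm x)"
proof (intro iffI)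
  assume n: "norming \<phi> x"
  then have bl: "bounded_linear \<phi>" by (simp add: norming_def dual_bounded_linear)
  have "onorm \<phi> \<le> 1" using n by (intro onorm_bound) (simp_all add: norming_def)
  moreover have "norm x \<le> onorm \<phi> * norm x"
    using onorm[OF bl, of x] n by (simp add: norming_def)
  ultimately show "\<phi> \<in> dual smul \<and> onorm \<phi> = 1 \<and> \<phi> x = of_real (norm x)"
    using n assms by (simp add: norming_def)
next
  assume n: "\<phi> \<in> dual smul \<and> onorm \<phi> = 1 \<and> \<phi> x = of_real (norm x)"
  then show "norming \<phi> x"
    using onorm[of \<phi>] by (simp add: norming_def dual_bounded_linear)
qed

text \<open>The estimate behind Smulian's theorem. From \<open>re (\<psi> (x + k)) \<le> \<parallel>x + k\<parallel>\<close> and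
  \<open>re (\<psi> x) \<ge> \<parallel>x\<parallel> - 2 \<parallel>y - x\<parallel>\<close> the increment \<open>\<parallel>x + k\<parallel> - \<parallel>x\<parallel>\<close> bounds \<open>re (\<psi> k)\<close> up to an error of
  \<open>2 \<parallel>y - x\<parallel>\<close>. With \<open>y = x\<close> this gives uniqueness of norming functionals, with \<open>y\<close> tending to \<open>x\<close>
  their continuity. Only increments of one fixed length \<open>\<delta>\<close> enter, so that \<open>\<delta>\<close> can be chosen before \<open>y\<close>.\<close>

lemma norming_close_to_derivative:
  assumes \<psi>: "norming \<psi> y" and \<phi>: "\<phi> \<in> dual smul" and "0 < \<delta>" "0 \<le> \<epsilon>"
    and der: "\<And>k. norm k = \<delta> \<Longrightarrow> norm (x + k) - norm x - re (\<phi> k) \<le> \<epsilon> * \<delta>"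
  shows "norm (\<psi> h - \<phi> h) \<le> (\<epsilon> + 2 * norm (y - x) / \<delta>) * norm h"
proof (rule dual_norm_leI[where \<omega> = "\<lambda>h. \<psi> h - \<phi> h"])
  have d: "\<psi> \<in> dual smul" using \<psi> by (simp add: norming_def)
  then show "(\<lambda>h. \<psi> h - \<phi> h) \<in> dual smul" using \<phi> by (rule dual_diff)
  interpret bounded_linear \<psi> using d by (rule dual_bounded_linear)
  have re_le: "re (\<psi> k) \<le> norm k" for k
  proof -
    have "re (\<psi> k) \<le> norm (\<psi> k)" using abs_re_le_norm[of "\<psi> k"] by simp
    also have "\<dots> \<le> norm k" using \<psi> by (simp add: norming_def)
    finally show ?thesis .
  qed
  fix k :: 'x assume k: "norm k = \<delta>"
  have "re (\<psi> x) + re (\<psi> k) \<le> norm (x + k)"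
    using re_le[of "x + k"] by (simp add: add re_add)
  moreover have "re (\<psi> x) = norm y - re (\<psi> (y - x))"
    using \<psi> by (simp add: diff re_diff norming_def re_of_real)
  moreover have "re (\<psi> (y - x)) \<le> norm (y - x)" by (rule re_le)
  moreover have "norm x \<le> norm y + norm (y - x)"
    by (metis norm_minus_commute norm_triangle_sub)
  ultimately have "re (\<psi> k - \<phi> k) \<le> \<epsilon> * \<delta> + 2 * norm (y - x)"
    using der[OF k] by (simp add: re_diff)
  also have "\<dots> = (\<epsilon> + 2 * norm (y - x) / \<delta>) * \<delta>"
    using \<open>0 < \<delta>\<close> by (simp add: field_simps)
  finally show "re (\<psi> k - \<phi> k) \<le> (\<epsilon> + 2 * norm (y - x) / \<delta>) * \<delta>" .
qed (use assms in auto)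

end

locale frechet_smooth_over = banach_over smul
  for smul :: "'f::real_or_complex \<Rightarrow> 'x::banach \<Rightarrow> 'x" +
  assumes frechet: "frechet_differentiable_norm smul"
begin

abbreviation F :: "'x \<Rightarrow> 'x \<Rightarrow> 'f" where
  "F \<equiv> support_functional smul"

lemma norm_derivative_exists:
  assumes "x \<noteq> 0"
  obtains \<phi> where "\<phi> \<in> dual smul"
    "\<And>\<epsilon>. 0 < \<epsilon> \<Longrightarrow>
      \<exists>\<delta>>0. \<forall>h. norm h \<le> \<delta> \<longrightarrow> \<bar>norm (x + h) - norm x - re (\<phi> h)\<bar> \<le> \<epsilon> * norm h"
proof -
  obtain \<phi> where \<phi>: "\<phi> \<in> dual smul"
    and lim: "((\<lambda>h. \<bar>norm (x + h) - norm x - re (\<phi> h)\<bar> / norm h) \<longlongrightarrow> 0) (at 0)"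
    using frechet assms unfolding frechet_differentiable_norm_def by blast
  interpret bounded_linear \<phi> using \<phi> by (rule dual_bounded_linear)
  show thesis
  proof (rule that[OF \<phi>])
    fix \<epsilon> :: real assume "0 < \<epsilon>"
    then have "\<forall>\<^sub>F h in at 0. \<bar>norm (x + h) - norm x - re (\<phi> h)\<bar> / norm h < \<epsilon>"
      using lim by (intro order_tendstoD)
    then obtain d where d: "d > 0"
      "\<And>h. h \<noteq> 0 \<Longrightarrow> dist h 0 < d \<Longrightarrow> \<bar>norm (x + h) - norm x - re (\<phi> h)\<bar> / norm h < \<epsilon>"
      unfolding eventually_at by blast
    have "\<bar>norm (x + h) - norm x - re (\<phi> h)\<bar> \<le> \<epsilon> * norm h" if "norm h \<le> d / 2" for h
    proof (cases "h = 0")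
      case True
      then show ?thesis
        using re_of_real[of 0, where 'a = 'f] by (simp add: zero)
    next
      case False
      then have "\<bar>norm (x + h) - norm x - re (\<phi> h)\<bar> / norm h < \<epsilon>"
        using d that by (intro d(2)) auto
      then show ?thesis using False by (simp add: field_simps)
    qed
    then show "\<exists>\<delta>>0. \<forall>h. norm h \<le> \<delta> \<longrightarrow>
        \<bar>norm (x + h) - norm x - re (\<phi> h)\<bar> \<le> \<epsilon> * norm h"
      using \<open>d > 0\<close> by (intro exI[of _ "d / 2"]) auto
  qed
qed

text \<open>The triangle inequality bounds the derivative in every direction, and along \<open>x\<close> itself the norm
  is linear with slope \<open>\<parallel>x\<parallel>\<close>, so the bound is attained there.\<close>

lemma norm_derivative_norming:
  assumes "x \<noteq> 0" and \<phi>: "\<phi> \<in> dual smul"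
    and der: "\<And>\<epsilon>. 0 < \<epsilon> \<Longrightarrow>
      \<exists>\<delta>>0. \<forall>h. norm h \<le> \<delta> \<longrightarrow> \<bar>norm (x + h) - norm x - re (\<phi> h)\<bar> \<le> \<epsilon> * norm h"
  shows "norming \<phi> x"
proof -
  have bound: "norm (\<phi> h) \<le> norm h" for h
  proof (rule le_if_le_add_epsilon_mult[OF norm_ge_zero])
    fix \<epsilon> :: real assume \<epsilon>: "0 < \<epsilon>"
    from der[OF \<epsilon>] obtain \<delta> where \<delta>: "\<delta> > 0"
      "\<And>h. norm h \<le> \<delta> \<Longrightarrow> \<bar>norm (x + h) - norm x - re (\<phi> h)\<bar> \<le> \<epsilon> * norm h" by blast
    have "norm (\<phi> h) \<le> (1 + \<epsilon>) * norm h"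
    proof (rule dual_norm_leI[OF \<phi> \<open>\<delta> > 0\<close>])
      fix k :: 'x assume k: "norm k = \<delta>"
      have "re (\<phi> k) \<le> norm (x + k) - norm x + \<epsilon> * \<delta>"
        using \<delta>(2)[of k] k by (simp add: abs_le_iff)
      also have "\<dots> \<le> (1 + \<epsilon>) * \<delta>"
        using norm_triangle_ineq[of x k] k by (simp add: algebra_simps)
      finally show "re (\<phi> k) \<le> (1 + \<epsilon>) * \<delta>" .
    qed (use \<epsilon> in simp)
    then show "norm (\<phi> h) \<le> norm h + \<epsilon> * norm h" by (simp add: algebra_simps)
  qed
  have "norm x \<le> re (\<phi> x)"
  proof (rule field_le_epsilon)
    fix e :: real assume "0 < e"
    then have "0 < e / norm x" using \<open>x \<noteq> 0\<close> by simp
    from der[OF this] obtain \<delta> where \<delta>: "\<delta> > 0"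
      "\<And>h. norm h \<le> \<delta> \<Longrightarrow> \<bar>norm (x + h) - norm x - re (\<phi> h)\<bar> \<le> e / norm x * norm h" by blast
    define t where "t = \<delta> / norm x"
    have t: "0 < t" using \<delta> \<open>x \<noteq> 0\<close> by (simp add: t_def)
    have "norm (x + t *\<^sub>R x) = (1 + t) * norm x"
      using t by (metis abs_of_pos add_pos_pos norm_scaleR scaleR_add_left scaleR_one zero_less_one)
    moreover have "\<bar>norm (x + t *\<^sub>R x) - norm x - re (\<phi> (t *\<^sub>R x))\<bar> \<le> e / norm x * norm (t *\<^sub>R x)"
      using t \<open>x \<noteq> 0\<close> \<open>\<delta> > 0\<close> by (intro \<delta>(2)) (simp add: t_def)
    ultimately have "\<bar>t * norm x - t * re (\<phi> x)\<bar> \<le> e * t"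
      using t \<open>x \<noteq> 0\<close> \<phi> by (simp add: dual_scaleR re_of_real_mult algebra_simps)
    then have "t * norm x \<le> t * (re (\<phi> x) + e)"
      by (simp add: abs_le_iff algebra_simps)
    then show "norm x \<le> re (\<phi> x) + e" using t by simp
  qed
  moreover have "re (\<phi> x) \<le> norm x"
    using abs_re_le_norm[of "\<phi> x"] bound[of x] by simp
  ultimately have "\<phi> x = of_real (norm x)"
    using eq_of_real_if_norm_le_re[of "\<phi> x"] bound[of x] by simp
  then show ?thesis using \<phi> bound by (simp add: norming_def)
qed

lemma norming_unique:
  assumes "x \<noteq> 0" "norming \<psi> x" "norming \<psi>' x"
  shows "\<psi> = \<psi>'"
proof -
  obtain \<phi> where \<phi>: "\<phi> \<in> dual smul"
    "\<And>\<epsilon>. 0 < \<epsilon> \<Longrightarrow>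
      \<exists>\<delta>>0. \<forall>h. norm h \<le> \<delta> \<longrightarrow> \<bar>norm (x + h) - norm x - re (\<phi> h)\<bar> \<le> \<epsilon> * norm h"
    using norm_derivative_exists[OF \<open>x \<noteq> 0\<close>] by blast
  have "\<psi> h = \<phi> h" if \<psi>: "norming \<psi> x" for \<psi> h
  proof -
    have "norm (\<psi> h - \<phi> h) \<le> 0"
    proof (rule le_if_le_add_epsilon_mult[OF norm_ge_zero])
      fix \<epsilon> :: real assume \<epsilon>: "0 < \<epsilon>"
      from \<phi>(2)[OF \<epsilon>] obtain \<delta> where \<delta>: "\<delta> > 0"
        "\<And>h. norm h \<le> \<delta> \<Longrightarrow> \<bar>norm (x + h) - norm x - re (\<phi> h)\<bar> \<le> \<epsilon> * norm h" by blast
      have "norm (\<psi> h - \<phi> h) \<le> (\<epsilon> + 2 * norm (x - x) / \<delta>) * norm h"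
        using \<psi> \<phi>(1) \<open>\<delta> > 0\<close> less_imp_le[OF \<epsilon>]
      proof (rule norming_close_to_derivative)
        fix k :: 'x assume "norm k = \<delta>"
        then show "norm (x + k) - norm x - re (\<phi> k) \<le> \<epsilon> * \<delta>"
          using \<delta>(2)[of k] by simp
      qed
      then show "norm (\<psi> h - \<phi> h) \<le> 0 + \<epsilon> * norm h" by simp
    qed
    then show ?thesis by simp
  qed
  then show ?thesis using assms by (metis ext)
qed

lemma support_functional_eqI:
  assumes "x \<noteq> 0" "norming \<phi> x"
  shows "F x = \<phi>"
  unfolding support_functional_def norming_iff_onorm[OF \<open>x \<noteq> 0\<close>, symmetric]
  using assms norming_unique by (intro the_equality) auto

lemma support_functional_norming: "x \<noteq> 0 \<Longrightarrow> norming (F x) x"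
  by (metis norm_derivative_exists norm_derivative_norming support_functional_eqI)

lemma support_functional_linear: "x \<noteq> 0 \<Longrightarrow> bounded_linear (F x)"
  using support_functional_norming dual_bounded_linear by (auto simp: norming_def)

lemma support_functional_smul_right: "x \<noteq> 0 \<Longrightarrow> F x (smul a h) = a * F x h"
  using support_functional_norming dual_smul by (auto simp: norming_def)

lemma norm_support_functional_le: "x \<noteq> 0 \<Longrightarrow> norm (F x h) \<le> norm h"
  using support_functional_norming by (auto simp: norming_def)

lemma support_functional_self: "x \<noteq> 0 \<Longrightarrow> F x x = of_real (norm x)"
  using support_functional_norming by (auto simp: norming_def)

lemma support_functional_smul_left:
  assumes "x \<noteq> 0" "a \<noteq> 0"
  shows "F (smul a x) h = of_real (1 / norm a) * conjg a * F x h"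
proof -
  have "norming (\<lambda>h. of_real (1 / norm a) * conjg a * F x h) (smul a x)"
    unfolding norming_def
  proof (intro conjI allI)
    show "(\<lambda>h. of_real (1 / norm a) * conjg a * F x h) \<in> dual smul"
      using support_functional_norming[OF \<open>x \<noteq> 0\<close>] by (intro dual_mult) (simp add: norming_def)
    show "norm (of_real (1 / norm a) * conjg a * F x h) \<le> norm h" for h
      using assms by (simp add: norm_mult norm_conjg norm_divide norm_support_functional_le)
    have "of_real (1 / norm a) * conjg a * F x (smul a x)
        = of_real (1 / norm a) * (a * conjg a) * of_real (norm x)"
      using assms by (simp add: support_functional_smul_right support_functional_self)
    also have "\<dots> = of_real (1 / norm a * (norm a)\<^sup>2 * norm x)"
      by (simp only: mult_conjg_of_real of_real_mult)
    also have "1 / norm a * (norm a)\<^sup>2 * norm x = norm (smul a x)"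
      using assms by (simp add: power2_eq_square norm_scale)
    finally show "of_real (1 / norm a) * conjg a * F x (smul a x) = of_real (norm (smul a x))" .
  qed
  moreover have "smul a x \<noteq> 0" using assms by (simp add: scale_eq_0_iff)
  ultimately show ?thesis by (simp add: support_functional_eqI)
qed

lemma support_functional_norm_continuous:
  assumes "x \<noteq> 0" "0 < \<eta>"
  shows "\<exists>d>0. \<forall>y. y \<noteq> 0 \<longrightarrow> norm (y - x) < d \<longrightarrow> (\<forall>h. norm (F y h - F x h) \<le> \<eta> * norm h)"
proof -
  obtain \<phi> where \<phi>: "\<phi> \<in> dual smul"
    "\<And>\<epsilon>. 0 < \<epsilon> \<Longrightarrow>
      \<exists>\<delta>>0. \<forall>h. norm h \<le> \<delta> \<longrightarrow> \<bar>norm (x + h) - norm x - re (\<phi> h)\<bar> \<le> \<epsilon> * norm h"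
    using norm_derivative_exists[OF \<open>x \<noteq> 0\<close>] by blast
  have Fx: "F x = \<phi>"
    using \<open>x \<noteq> 0\<close> norm_derivative_norming[OF \<open>x \<noteq> 0\<close> \<phi>] by (rule support_functional_eqI)
  have "0 < \<eta> / 2" using assms by simp
  from \<phi>(2)[OF this] obtain \<delta> where \<delta>: "\<delta> > 0"
    "\<And>h. norm h \<le> \<delta> \<Longrightarrow> \<bar>norm (x + h) - norm x - re (\<phi> h)\<bar> \<le> \<eta> / 2 * norm h" by blast
  \<comment> \<open>The increments of length \<open>\<delta>\<close> contribute \<open>\<eta> / 2\<close>; the bound on \<open>y - x\<close> makes
    \<open>2 * norm (y - x) / \<delta>\<close> at most the other half.\<close>
  have "norm (F y h - F x h) \<le> \<eta> * norm h" if "y \<noteq> 0" "norm (y - x) < \<eta> * \<delta> / 4" for y h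
  proof -
    have "norm (F y h - \<phi> h) \<le> (\<eta> / 2 + 2 * norm (y - x) / \<delta>) * norm h"
      using support_functional_norming[OF \<open>y \<noteq> 0\<close>] \<phi>(1) \<open>\<delta> > 0\<close> less_imp_le[OF \<open>0 < \<eta> / 2\<close>]
    proof (rule norming_close_to_derivative)
      fix k :: 'x assume "norm k = \<delta>"
      then show "norm (x + k) - norm x - re (\<phi> k) \<le> \<eta> / 2 * \<delta>"
        using \<delta>(2)[of k] by (simp only: abs_le_iff)
    qed
    also have "\<dots> \<le> \<eta> * norm h"
    proof (rule mult_right_mono)
      show "\<eta> / 2 + 2 * norm (y - x) / \<delta> \<le> \<eta>"
        using that \<open>\<delta> > 0\<close> by (simp add: field_simps)
    qed simp
    finally show ?thesis by (simp add: Fx)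
  qed
  then show ?thesis
    using \<open>\<delta> > 0\<close> \<open>0 < \<eta>\<close> by (intro exI[of _ "\<eta> * \<delta> / 4"]) auto
qed

text \<open>Joint continuity: split \<open>F\<^bsub>u i\<^esub> (v i) = F\<^bsub>u i\<^esub> h + F\<^bsub>u i\<^esub> (v i - h)\<close>, where the second term is at
  most \<open>\<parallel>v i - h\<parallel>\<close>. Convergence of \<open>u\<close> makes \<open>u i \<noteq> 0\<close> eventually, so the unspecified functional
  \<open>F\<^sub>0\<close> does no harm.\<close>

lemma tendsto_support_functional:
  assumes "x \<noteq> 0" and u: "u \<longlonglongrightarrow> x" and v: "v \<longlonglongrightarrow> h"
  shows "(\<lambda>i. F (u i) (v i)) \<longlonglongrightarrow> F x h"
proof -
  have u0: "\<forall>\<^sub>F i in sequentially. u i \<noteq> 0"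
    using u \<open>x \<noteq> 0\<close> by (rule tendsto_imp_eventually_ne)
  have "(\<lambda>i. F (u i) h) \<longlonglongrightarrow> F x h"
  proof (rule tendstoI)
    fix e :: real assume "0 < e"
    have pos: "0 < norm h + 1" by (simp add: add_nonneg_pos)
    then have "0 < e / (norm h + 1)" using \<open>0 < e\<close> by simp
    from support_functional_norm_continuous[OF \<open>x \<noteq> 0\<close> this] obtain d where d: "d > 0"
      "\<And>y h'. y \<noteq> 0 \<Longrightarrow> norm (y - x) < d \<Longrightarrow> norm (F y h' - F x h') \<le> e / (norm h + 1) * norm h'"
      by blast
    have small: "e / (norm h + 1) * norm h < e"
    proof -
      have "e * norm h < e * (norm h + 1)" using \<open>0 < e\<close> by simp
      then show ?thesis using pos by (simp add: pos_divide_less_eq)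
    qed
    show "\<forall>\<^sub>F i in sequentially. dist (F (u i) h) (F x h) < e"
      using u0 tendstoD[OF u \<open>d > 0\<close>]
    proof eventually_elim
      case (elim i)
      then show ?case using d(2)[of "u i" h] small by (simp add: dist_norm)
    qed
  qed
  moreover have "(\<lambda>i. F (u i) (v i - h)) \<longlonglongrightarrow> 0"
  proof (rule Lim_null_comparison)
    show "\<forall>\<^sub>F i in sequentially. norm (F (u i) (v i - h)) \<le> norm (v i - h)"
      using u0 by eventually_elim (rule norm_support_functional_le)
    show "(\<lambda>i. norm (v i - h)) \<longlonglongrightarrow> 0"
      using v by (simp add: LIM_zero tendsto_norm_zero)
  qed
  ultimately have "(\<lambda>i. F (u i) h + F (u i) (v i - h)) \<longlonglongrightarrow> F x h"
    using tendsto_add by fastforce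
  moreover have "\<forall>\<^sub>F i in sequentially. F (u i) h + F (u i) (v i - h) = F (u i) (v i)"
    using u0 by eventually_elim
      (simp add: linear_diff bounded_linear.linear support_functional_linear)
  ultimately show ?thesis by (rule Lim_transform_eventually)
qed

end


section \<open>Strong measurability\<close>

text \<open>Make the sequence constant on a null set that contains the points of divergence, pass to the
  pointwise limit, and use completeness to undo the change.\<close>

lemma (in complete_measure) borel_measurable_AE_LIMSEQ_metric:
  fixes f :: "'a \<Rightarrow> 'b::metric_space"
  assumes u: "\<And>i::nat. u i \<in> borel_measurable M"
    and lim: "AE s in M. (\<lambda>i. u i s) \<longlonglongrightarrow> f s"
  shows "f \<in> borel_measurable M"
proof -
  obtain N where N: "N \<in> null_sets M" "{s \<in> space M. \<not> (\<lambda>i. u i s) \<longlonglongrightarrow> f s} \<subseteq> N"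
    using AE_E[OF lim] by (metis null_setsI)
  then have NM: "N \<in> sets M" by auto
  define g where "g s = (if s \<in> N then undefined else f s)" for s
  have g: "g \<in> borel_measurable M"
  proof (rule borel_measurable_LIMSEQ_metric)
    show "(\<lambda>s. if s \<in> N then undefined else u i s) \<in> borel_measurable M" for i
      using u NM by (intro measurable_If_set) auto
    show "(\<lambda>i. if s \<in> N then undefined else u i s) \<longlonglongrightarrow> g s" if "s \<in> space M" for s
      using N(2) that by (auto simp: g_def)
  qed
  show ?thesis
  proof (rule measurableI)
    fix A :: "'b set" assume "A \<in> sets borel"
    then have 1: "g -` A \<inter> space M \<in> sets M" using g by (simp add: measurable_sets)
    have 2: "AE s in M. s \<in> g -` A \<inter> space M \<longleftrightarrow> s \<in> f -` A \<inter> space M"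
      using AE_not_in[OF N(1)] by eventually_elim (simp add: g_def)
    show "f -` A \<inter> space M \<in> sets M"
      using in_sets_AE[OF 2 1] by simp
  qed simp
qed

lemma strongly_measurable_smul:
  fixes smul :: "'f::real_or_complex \<Rightarrow> 'x::banach \<Rightarrow> 'x"
  assumes "banach_over smul" "strongly_measurable M f"
  shows "strongly_measurable M (\<lambda>s. smul a (f s))"
proof -
  interpret banach_over smul by fact
  have bl: "bounded_linear (smul a)"
  proof (rule bounded_linear_intro)
    fix x y :: 'x and r :: real
    show "smul a (x + y) = smul a x + smul a y" by (rule scale_right_distrib)
    show "smul a (r *\<^sub>R x) = r *\<^sub>R smul a x"
      unfolding scale_of_real[symmetric] by (rule scale_left_commute)
    show "norm (smul a x) \<le> norm x * norm a" by (simp add: norm_scale mult.commute)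
  qed
  obtain u where u: "\<And>i::nat. simple_function M (u i)" "AE s in M. (\<lambda>i. u i s) \<longlonglongrightarrow> f s"
    using assms unfolding strongly_measurable_def by blast
  show ?thesis
    unfolding strongly_measurable_def
  proof (intro exI conjI allI)
    show "simple_function M (\<lambda>s. smul a (u i s))" for i
      using u(1) by (rule simple_function_compose1)
    show "AE s in M. (\<lambda>i. smul a (u i s)) \<longlonglongrightarrow> smul a (f s)"
      using u(2) by eventually_elim (rule bounded_linear.tendsto[OF bl])
  qed
qed

lemma strongly_measurable_add:
  assumes "strongly_measurable M f" "strongly_measurable M g"
  shows "strongly_measurable M (\<lambda>s. f s + g s)"
proof -
  obtain u where u: "\<And>i::nat. simple_function M (u i)" "AE s in M. (\<lambda>i. u i s) \<longlonglongrightarrow> f s"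
    using assms(1) unfolding strongly_measurable_def by blast
  obtain v where v: "\<And>i::nat. simple_function M (v i)" "AE s in M. (\<lambda>i. v i s) \<longlonglongrightarrow> g s"
    using assms(2) unfolding strongly_measurable_def by blast
  show ?thesis
    unfolding strongly_measurable_def
  proof (intro exI conjI allI)
    show "simple_function M (\<lambda>s. u i s + v i s)" for i
      using u(1) v(1) by (rule simple_function_compose2)
    show "AE s in M. (\<lambda>i. u i s + v i s) \<longlonglongrightarrow> f s + g s"
      using u(2) v(2) by eventually_elim (rule tendsto_add)
  qed
qed

lemma (in complete_measure) borel_measurable_norm_strongly_measurable:
  assumes "strongly_measurable M f"
  shows "(\<lambda>s. norm (f s)) \<in> borel_measurable M"
proof -
  obtain u where u: "\<And>i::nat. simple_function M (u i)" "AE s in M. (\<lambda>i. u i s) \<longlonglongrightarrow> f s"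
    using assms unfolding strongly_measurable_def by blast
  show ?thesis
  proof (rule borel_measurable_AE_LIMSEQ_metric)
    show "(\<lambda>s. norm (u i s)) \<in> borel_measurable M" for i
      using simple_function_compose1[OF u(1)] by (rule borel_measurable_simple_function)
    show "AE s in M. (\<lambda>i. norm (u i s)) \<longlonglongrightarrow> norm (f s)"
      using u(2) by eventually_elim (rule tendsto_norm)
  qed
qed

lemma (in complete_measure) sets_nonzero_set:
  assumes "strongly_measurable M g"
  shows "nonzero_set M g \<in> sets M"
proof -
  have [measurable]: "(\<lambda>s. norm (g s)) \<in> borel_measurable M"
    using assms by (rule borel_measurable_norm_strongly_measurable)
  have "nonzero_set M g = {s \<in> space M. norm (g s) \<noteq> 0}"
    by (auto simp: nonzero_set_def)
  also have "\<dots> \<in> sets M" by measurable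
  finally show ?thesis .
qed

locale frechet_smooth_Lp = frechet_smooth_over smul + complete_measure M
  for smul :: "'f::real_or_complex \<Rightarrow> 'x::banach \<Rightarrow> 'x" and M :: "'s measure" +
  fixes p :: real
  assumes p_gt_1: "1 < p"
begin

text \<open>Approximating both arguments by simple functions keeps everything scalar-valued, which avoids
  measurability of \<open>s \<mapsto> F\<^bsub>g s\<^esub>\<close> as a map into the possibly non-separable dual. The indicator is that
  of the limit \<open>g\<close> rather than of its approximants, so that all terms are
  \<open>0\<close> where \<open>g\<close> vanishes and \<open>F\<close> gives no control.\<close>

lemma borel_measurable_sip_integrand:
  assumes f: "strongly_measurable M f" and g: "strongly_measurable M g"
  shows "(\<lambda>s. indicator (nonzero_set M g) s *\<^sub>R sip_integrand smul p f g s) \<in> borel_measurable M"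
proof -
  obtain u where u: "\<And>i::nat. simple_function M (u i)" "AE s in M. (\<lambda>i. u i s) \<longlonglongrightarrow> f s"
    using f unfolding strongly_measurable_def by blast
  obtain v where v: "\<And>i::nat. simple_function M (v i)" "AE s in M. (\<lambda>i. v i s) \<longlonglongrightarrow> g s"
    using g unfolding strongly_measurable_def by blast
  show ?thesis
  proof (rule borel_measurable_AE_LIMSEQ_metric)
    fix i
    have "simple_function M (\<lambda>s. sip_integrand smul p (u i) (v i) s)"
      unfolding sip_integrand_def using v(1) u(1)
      by (rule simple_function_compose2[where
            h = "\<lambda>y x. of_real (norm y powr (p - 1)) * support_functional smul y x"])
    then show "(\<lambda>s. indicator (nonzero_set M g) s *\<^sub>R sip_integrand smul p (u i) (v i) s)
        \<in> borel_measurable M"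
      using sets_nonzero_set[OF g]
      by (intro borel_measurable_scaleR borel_measurable_indicator borel_measurable_simple_function)
  next
    show "AE s in M. (\<lambda>i. indicator (nonzero_set M g) s *\<^sub>R sip_integrand smul p (u i) (v i) s)
        \<longlonglongrightarrow> indicator (nonzero_set M g) s *\<^sub>R sip_integrand smul p f g s"
      using u(2) v(2)
    proof eventually_elim
      case (elim s)
      show ?case
      proof (cases "g s = 0")
        case True
        then show ?thesis by (simp add: nonzero_set_def)
      next
        case False
        have "(\<lambda>i. norm (v i s) powr (p - 1)) \<longlonglongrightarrow> norm (g s) powr (p - 1)"
          using elim False by (intro tendsto_powr tendsto_norm tendsto_const) auto
        then show ?thesis
          unfolding sip_integrand_def using elim False
          by (intro tendsto_scaleR tendsto_const tendsto_mult tendsto_of_real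
              tendsto_support_functional)
      qed
    qed
  qed
qed

lemma norm_sip_integrand_le:
  "norm (indicator (nonzero_set M g) s *\<^sub>R sip_integrand smul p f g s)
    \<le> norm (f s) * norm (g s) powr (p - 1)"
proof (cases "g s = 0")
  case False
  have "norm (sip_integrand smul p f g s) \<le> norm (f s) * norm (g s) powr (p - 1)"
    using norm_support_functional_le[OF False, of "f s"]
    by (simp add: sip_integrand_def norm_mult mult.commute[of "norm (g s) powr _"] mult_right_mono)
  then show ?thesis by (auto simp: indicator_def)
qed (simp add: nonzero_set_def)

end

section \<open>Hoelder's inequality and the space of p-integrable functions\<close>

lemma Young_powr:
  fixes a b p :: real
  assumes "1 < p" "0 \<le> a" "0 \<le> b"
  shows "a * b powr (p - 1) \<le> a powr p / p + b powr p * (1 - 1 / p)"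
proof -
  have "a * b powr (p - 1) \<le> a powr p / p + (b powr (p - 1)) powr (p / (p - 1)) / (p / (p - 1))"
    using assms by (intro Youngs_inequality) (auto simp: field_simps)
  also have "(b powr (p - 1)) powr (p / (p - 1)) = b powr p"
    using assms by (simp add: powr_powr)
  also have "b powr p / (p / (p - 1)) = b powr p * (1 - 1 / p)"
    using assms by (simp add: field_simps)
  finally show ?thesis .
qed

text \<open>Hoelder's inequality for \<open>u\<close> and \<open>v powr (p - 1)\<close>, whose exponents \<open>p\<close> and \<open>p / (p - 1)\<close> are
  conjugate: integrate Young's inequality for the normalised functions \<open>u / A\<close> and \<open>v / B\<close>.\<close>

lemma Hoelder_powr:
  fixes u v :: "'s \<Rightarrow> real"
  assumes "1 < p" and [measurable]: "u \<in> borel_measurable M" "v \<in> borel_measurable M"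
    and nonneg: "\<And>s. 0 \<le> u s" "\<And>s. 0 \<le> v s"
    and int: "integrable M (\<lambda>s. u s powr p)" "integrable M (\<lambda>s. v s powr p)"
    and B0: "0 < (\<integral>s. v s powr p \<partial>M)"
  shows "integrable M (\<lambda>s. u s * v s powr (p - 1))" (is ?int)
    and "(\<integral>s. u s * v s powr (p - 1) \<partial>M)
      \<le> (\<integral>s. u s powr p \<partial>M) powr (1 / p) * (\<integral>s. v s powr p \<partial>M) powr (1 - 1 / p)"
proof -
  show i: ?int
  proof (rule Bochner_Integration.integrable_bound)
    show "integrable M (\<lambda>s. u s powr p / p + v s powr p * (1 - 1 / p))"
      using int by simp
    show "AE s in M. norm (u s * v s powr (p - 1)) \<le> norm (u s powr p / p + v s powr p * (1 - 1 / p))"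
    proof (rule AE_I2)
      fix s
      have "norm (u s * v s powr (p - 1)) = u s * v s powr (p - 1)"
        using nonneg by (simp add: abs_mult)
      also have "\<dots> \<le> u s powr p / p + v s powr p * (1 - 1 / p)"
        using \<open>1 < p\<close> nonneg by (intro Young_powr)
      finally show "norm (u s * v s powr (p - 1)) \<le> norm (u s powr p / p + v s powr p * (1 - 1 / p))"
        by simp
    qed
  qed measurable
  define a where "a = (\<integral>s. u s powr p \<partial>M)"
  define b where "b = (\<integral>s. v s powr p \<partial>M)"
  have b: "0 < b" using B0 by (simp add: b_def)
  have "0 \<le> a" by (simp add: a_def)
  show "(\<integral>s. u s * v s powr (p - 1) \<partial>M)
      \<le> (\<integral>s. u s powr p \<partial>M) powr (1 / p) * (\<integral>s. v s powr p \<partial>M) powr (1 - 1 / p)"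
  proof (cases "a = 0")
    case True
    then have "AE s in M. u s powr p = 0"
      using int(1) by (subst integral_nonneg_eq_0_iff_AE[symmetric]) (simp_all add: a_def)
    then have "(\<integral>s. u s * v s powr (p - 1) \<partial>M) = (\<integral>s. 0 \<partial>M)"
      by (intro integral_cong_AE) auto
    then show ?thesis by simp
  next
    case False
    then have a: "0 < a" using \<open>0 \<le> a\<close> by simp
    define A where "A = a powr (1 / p)"
    define B where "B = b powr (1 / p)"
    have A: "0 < A" "A powr p = a" and B: "0 < B" "B powr p = b"
      using a b \<open>1 < p\<close> by (auto simp: A_def B_def powr_powr)
    have "(\<integral>s. u s * v s powr (p - 1) \<partial>M) / (A * B powr (p - 1))
        = (\<integral>s. (u s / A) * (v s / B) powr (p - 1) \<partial>M)"
      using nonneg B by (simp add: powr_divide field_simps flip: integral_divide_zero)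
    also have "\<dots> \<le> (\<integral>s. (u s powr p / a) / p + (v s powr p / b) * (1 - 1 / p) \<partial>M)"
    proof (rule integral_mono)
      have "integrable M (\<lambda>s. u s * v s powr (p - 1) / (A * B powr (p - 1)))"
        using i by simp
      then show "integrable M (\<lambda>s. (u s / A) * (v s / B) powr (p - 1))"
        using nonneg B by (simp add: powr_divide)
      show "integrable M (\<lambda>s. (u s powr p / a) / p + (v s powr p / b) * (1 - 1 / p))"
        using int by simp
      fix s
      have "(u s / A) * (v s / B) powr (p - 1)
          \<le> (u s / A) powr p / p + (v s / B) powr p * (1 - 1 / p)"
        using \<open>1 < p\<close> nonneg A B by (intro Young_powr) auto
      then show "(u s / A) * (v s / B) powr (p - 1)
          \<le> (u s powr p / a) / p + (v s powr p / b) * (1 - 1 / p)"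
        using nonneg A B by (simp add: powr_divide)
    qed
    also have "\<dots> = (a / a) / p + (b / b) * (1 - 1 / p)"
      using int by (simp add: a_def b_def)
    also have "\<dots> = 1" using a b by simp
    finally have "(\<integral>s. u s * v s powr (p - 1) \<partial>M) \<le> A * B powr (p - 1)"
      using A B by (simp add: divide_le_eq)
    also have "B powr (p - 1) = b powr (1 - 1 / p)"
      using \<open>1 < p\<close> by (simp add: B_def powr_powr field_simps)
    finally show ?thesis by (simp add: A_def a_def b_def)
  qed
qed

lemma Lp_fun_norm_cong_AE:
  "AE s in M. f s = g s \<Longrightarrow> Lp_fun_norm M p f = Lp_fun_norm M p g"
  unfolding Lp_fun_norm_def
  by (intro arg_cong[where f = "\<lambda>x. enn2real x powr (1 / p)"] nn_integral_cong_AE) auto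

lemma Lp_fun_norm_nonneg: "0 \<le> Lp_fun_norm M p f"
  by (simp add: Lp_fun_norm_def)

context frechet_smooth_Lp
begin

lemma Lp_fun_iff_integrable:
  "f \<in> Lp_fun M p \<longleftrightarrow> strongly_measurable M f \<and> integrable M (\<lambda>s. norm (f s) powr p)"
proof (cases "strongly_measurable M f")
  case True
  then have [measurable]: "(\<lambda>s. norm (f s)) \<in> borel_measurable M"
    by (rule borel_measurable_norm_strongly_measurable)
  show ?thesis using True by (simp add: Lp_fun_def integrable_iff_bounded)
qed (simp add: Lp_fun_def)

lemma Lp_fun_strongly_measurable: "f \<in> Lp_fun M p \<Longrightarrow> strongly_measurable M f"
  by (simp add: Lp_fun_def)

lemma Lp_fun_borel_measurable_norm: "f \<in> Lp_fun M p \<Longrightarrow> (\<lambda>s. norm (f s)) \<in> borel_measurable M"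
  by (simp add: Lp_fun_def borel_measurable_norm_strongly_measurable)

lemma Lp_fun_norm_eq_integral:
  assumes "f \<in> Lp_fun M p"
  shows "Lp_fun_norm M p f = (\<integral>s. norm (f s) powr p \<partial>M) powr (1 / p)"
  using Lp_fun_borel_measurable_norm[OF assms]
  by (simp add: Lp_fun_norm_def integral_eq_nn_integral)

lemma Lp_fun_norm_powr:
  "f \<in> Lp_fun M p \<Longrightarrow> Lp_fun_norm M p f powr p = (\<integral>s. norm (f s) powr p \<partial>M)"
  using p_gt_1 by (simp add: Lp_fun_norm_eq_integral powr_powr)

lemma integral_norm_powr_pos:
  assumes g: "g \<in> Lp_fun M p" and "\<not> (AE s in M. g s = 0)"
  shows "0 < (\<integral>s. norm (g s) powr p \<partial>M)"
proof -
  have "(\<integral>s. norm (g s) powr p \<partial>M) \<noteq> 0"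
    using assms integral_nonneg_eq_0_iff_AE[of M "\<lambda>s. norm (g s) powr p"]
    by (auto simp: Lp_fun_iff_integrable)
  then show ?thesis by (simp add: less_le)
qed

lemma Lp_fun_norm_pos:
  "g \<in> Lp_fun M p \<Longrightarrow> \<not> (AE s in M. g s = 0) \<Longrightarrow> 0 < Lp_fun_norm M p g"
  by (simp add: integral_norm_powr_pos Lp_fun_norm_eq_integral less_imp_neq[symmetric])

lemma Lp_fun_smul:
  assumes "f \<in> Lp_fun M p"
  shows "(\<lambda>s. smul a (f s)) \<in> Lp_fun M p"
  using assms
  by (simp add: Lp_fun_iff_integrable norm_scale powr_mult strongly_measurable_smul[OF banach_over_axioms])

lemma Lp_fun_norm_smul:
  assumes "f \<in> Lp_fun M p"
  shows "Lp_fun_norm M p (\<lambda>s. smul a (f s)) = norm a * Lp_fun_norm M p f"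
  using assms p_gt_1
  by (simp add: Lp_fun_norm_eq_integral Lp_fun_smul norm_scale powr_mult powr_powr)

lemma Lp_fun_add:
  assumes f: "f \<in> Lp_fun M p" and g: "g \<in> Lp_fun M p"
  shows "(\<lambda>s. f s + g s) \<in> Lp_fun M p"
  unfolding Lp_fun_iff_integrable
proof
  show sm: "strongly_measurable M (\<lambda>s. f s + g s)"
    using f g by (simp add: Lp_fun_strongly_measurable strongly_measurable_add)
  have [measurable]: "(\<lambda>s. norm (f s + g s)) \<in> borel_measurable M"
    using sm by (rule borel_measurable_norm_strongly_measurable)
  show "integrable M (\<lambda>s. norm (f s + g s) powr p)"
  proof (rule Bochner_Integration.integrable_bound)
    show "integrable M (\<lambda>s. 2 powr p * (norm (f s) powr p + norm (g s) powr p))"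
      using f g by (simp add: Lp_fun_iff_integrable)
    show "AE s in M. norm (norm (f s + g s) powr p)
        \<le> norm (2 powr p * (norm (f s) powr p + norm (g s) powr p))"
    proof (rule AE_I2)
      fix s
      have "norm (f s + g s) \<le> 2 * max (norm (f s)) (norm (g s))"
        using norm_triangle_ineq[of "f s" "g s"] by simp
      then have "norm (f s + g s) powr p \<le> 2 powr p * max (norm (f s)) (norm (g s)) powr p"
        using p_gt_1 by (metis norm_ge_zero powr_mono2 powr_mult less_imp_le order_trans zero_le_one)
      also have "\<dots> \<le> 2 powr p * (norm (f s) powr p + norm (g s) powr p)"
        by (auto simp: max_def)
      finally show "norm (norm (f s + g s) powr p)
        \<le> norm (2 powr p * (norm (f s) powr p + norm (g s) powr p))" by simp
    qed
  qed measurable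
qed

section \<open>The bracket on functions\<close>

lemma integrable_norm_mult_norm_powr:
  assumes f: "f \<in> Lp_fun M p" and g: "g \<in> Lp_fun M p" and "\<not> (AE s in M. g s = 0)"
  shows "integrable M (\<lambda>s. norm (f s) * norm (g s) powr (p - 1))"
    and "(\<integral>s. norm (f s) * norm (g s) powr (p - 1) \<partial>M)
      \<le> Lp_fun_norm M p f * Lp_fun_norm M p g powr (p - 1)"
proof -
  have "Lp_fun_norm M p g powr (p - 1) = (\<integral>s. norm (g s) powr p \<partial>M) powr (1 - 1 / p)"
    using g p_gt_1 by (simp add: Lp_fun_norm_eq_integral powr_powr field_simps)
  then show "integrable M (\<lambda>s. norm (f s) * norm (g s) powr (p - 1))"
    and "(\<integral>s. norm (f s) * norm (g s) powr (p - 1) \<partial>M)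
      \<le> Lp_fun_norm M p f * Lp_fun_norm M p g powr (p - 1)"
    using Hoelder_powr[OF p_gt_1, of "\<lambda>s. norm (f s)" M "\<lambda>s. norm (g s)"]
      integral_norm_powr_pos[OF g] assms
    by (auto simp: Lp_fun_borel_measurable_norm Lp_fun_norm_eq_integral Lp_fun_iff_integrable)
qed

lemma set_integrable_sip_integrand:
  assumes f: "f \<in> Lp_fun M p" and g: "g \<in> Lp_fun M p"
  shows "set_integrable M (nonzero_set M g) (sip_integrand smul p f g)"
proof (cases "AE s in M. g s = 0")
  case True
  then have "AE s in M. indicator (nonzero_set M g) s *\<^sub>R sip_integrand smul p f g s = 0"
    by eventually_elim (simp add: nonzero_set_def)
  then show ?thesis
    unfolding set_integrable_def
    using borel_measurable_sip_integrand[of f g] f g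
    by (subst integrable_cong_AE[where g = "\<lambda>_. 0"]) (auto simp: Lp_fun_strongly_measurable)
next
  case False
  show ?thesis
    unfolding set_integrable_def
  proof (rule Bochner_Integration.integrable_bound)
    show "integrable M (\<lambda>s. norm (f s) * norm (g s) powr (p - 1))"
      using f g False by (rule integrable_norm_mult_norm_powr)
    show "(\<lambda>s. indicator (nonzero_set M g) s *\<^sub>R sip_integrand smul p f g s) \<in> borel_measurable M"
      using f g by (simp add: borel_measurable_sip_integrand Lp_fun_strongly_measurable)
    show "AE s in M. norm (indicator (nonzero_set M g) s *\<^sub>R sip_integrand smul p f g s)
        \<le> norm (norm (f s) * norm (g s) powr (p - 1))"
      using norm_sip_integrand_le[of g _ f] by (simp add: abs_mult)
  qed
qed

lemma sip_fun_cong_AE: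
  assumes "f \<in> Lp_fun M p" "f' \<in> Lp_fun M p" "g \<in> Lp_fun M p" "g' \<in> Lp_fun M p"
    and ff: "AE s in M. f s = f' s" and gg: "AE s in M. g s = g' s"
  shows "sip_fun smul M p f g = sip_fun smul M p f' g'"
proof -
  have "(AE s in M. g s = 0) \<longleftrightarrow> (AE s in M. g' s = 0)"
    using gg by (auto elim: AE_mp)
  moreover have "set_lebesgue_integral M (nonzero_set M g) (sip_integrand smul p f g)
      = set_lebesgue_integral M (nonzero_set M g') (sip_integrand smul p f' g')"
    unfolding set_lebesgue_integral_def
  proof (rule integral_cong_AE)
    show "AE s in M. indicator (nonzero_set M g) s *\<^sub>R sip_integrand smul p f g s
        = indicator (nonzero_set M g') s *\<^sub>R sip_integrand smul p f' g' s"
      using ff gg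
      by eventually_elim (simp add: indicator_def nonzero_set_def sip_integrand_def)
  qed (use assms in \<open>auto intro!: borel_measurable_sip_integrand Lp_fun_strongly_measurable\<close>)
  ultimately show ?thesis
    unfolding sip_fun_def using Lp_fun_norm_cong_AE[OF gg] by simp
qed

lemma sip_fun_linear:
  assumes f: "f \<in> Lp_fun M p" and h: "h \<in> Lp_fun M p" and g: "g \<in> Lp_fun M p"
  shows "sip_fun smul M p (\<lambda>s. smul a (f s) + smul b (h s)) g
    = a * sip_fun smul M p f g + b * sip_fun smul M p h g"
proof (cases "AE s in M. g s = 0")
  case False
  let ?I = "\<lambda>f. set_lebesgue_integral M (nonzero_set M g) (sip_integrand smul p f g)"
  have "?I (\<lambda>s. smul a (f s) + smul b (h s)) = a * ?I f + b * ?I h"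
  proof -
    have "?I (\<lambda>s. smul a (f s) + smul b (h s)) = set_lebesgue_integral M (nonzero_set M g)
        (\<lambda>s. a * sip_integrand smul p f g s + b * sip_integrand smul p h g s)"
      unfolding set_lebesgue_integral_def
    proof (rule Bochner_Integration.integral_cong)
      fix s
      show "indicator (nonzero_set M g) s *\<^sub>R sip_integrand smul p (\<lambda>s. smul a (f s) + smul b (h s)) g s
        = indicator (nonzero_set M g) s *\<^sub>R
          (a * sip_integrand smul p f g s + b * sip_integrand smul p h g s)"
      proof (cases "g s = 0")
        case False
        then have "F (g s) (smul a (f s) + smul b (h s)) = a * F (g s) (f s) + b * F (g s) (h s)"
          by (simp add: linear_add bounded_linear.linear support_functional_linear
              support_functional_smul_right)
        then show ?thesis by (simp add: sip_integrand_def algebra_simps)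
      qed (simp add: nonzero_set_def)
    qed simp
    also have "\<dots> = a * ?I f + b * ?I h"
      using set_integrable_sip_integrand[OF f g] set_integrable_sip_integrand[OF h g]
      by (simp add: set_integral_add)
    finally show ?thesis .
  qed
  then show ?thesis using False by (simp add: sip_fun_def algebra_simps)
qed (simp add: sip_fun_def)

text \<open>The integrand picks up \<open>|a| powr (p - 1) * conjg a / |a|\<close>, and the factor \<open>|a| powr (p - 2)\<close>
  in it is cancelled by the normalisation. For \<open>a = 0\<close> the value \<open>0\<close> at \<open>g = 0\<close> is what is needed.\<close>

lemma sip_fun_smul_right:
  assumes f: "f \<in> Lp_fun M p" and g: "g \<in> Lp_fun M p"
  shows "sip_fun smul M p f (\<lambda>s. smul a (g s)) = conjg a * sip_fun smul M p f g"
proof (cases "a = 0 \<or> (AE s in M. g s = 0)")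
  case True
  moreover have "AE s in M. smul a (g s) = 0"
    using True by (auto elim: AE_mp)
  ultimately show ?thesis by (auto simp: sip_fun_def conjg_zero)
next
  case False
  then have a: "a \<noteq> 0" by simp
  have "sip_integrand smul p f (\<lambda>s. smul a (g s)) s
      = of_real (norm a powr (p - 2)) * conjg a * sip_integrand smul p f g s"
    if "g s \<noteq> 0" for s
  proof -
    have "norm a powr (p - 1) / norm a = norm a powr (p - 2)"
      using a powr_diff[of "norm a" "p - 1" 1] by simp
    then have "(norm a * norm (g s)) powr (p - 1) * (1 / norm a)
        = norm a powr (p - 2) * norm (g s) powr (p - 1)"
      by (simp add: powr_mult flip: \<open>norm a powr (p - 1) / norm a = norm a powr (p - 2)\<close>)
    then have "of_real ((norm a * norm (g s)) powr (p - 1)) * of_real (1 / norm a)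
        = (of_real (norm a powr (p - 2) * norm (g s) powr (p - 1)) :: 'f)"
      by (simp only: of_real_mult[symmetric])
    moreover have "sip_integrand smul p f (\<lambda>s. smul a (g s)) s
        = of_real ((norm a * norm (g s)) powr (p - 1)) * of_real (1 / norm a)
          * (conjg a * F (g s) (f s))"
      using a that by (simp add: sip_integrand_def support_functional_smul_left norm_scale)
    ultimately show ?thesis by (simp add: sip_integrand_def mult_ac)
  qed
  then have "set_lebesgue_integral M (nonzero_set M (\<lambda>s. smul a (g s)))
        (sip_integrand smul p f (\<lambda>s. smul a (g s)))
      = set_lebesgue_integral M (nonzero_set M g)
        (\<lambda>s. of_real (norm a powr (p - 2)) * conjg a * sip_integrand smul p f g s)"
    using a unfolding set_lebesgue_integral_def
    by (intro Bochner_Integration.integral_cong) (auto simp: nonzero_set_def indicator_def)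
  also have "\<dots> = of_real (norm a powr (p - 2)) * conjg a *
        set_lebesgue_integral M (nonzero_set M g) (sip_integrand smul p f g)"
    by (rule set_integral_mult_right)
  finally have int: "set_lebesgue_integral M (nonzero_set M (\<lambda>s. smul a (g s)))
        (sip_integrand smul p f (\<lambda>s. smul a (g s)))
      = of_real (norm a powr (p - 2)) * conjg a *
        set_lebesgue_integral M (nonzero_set M g) (sip_integrand smul p f g)" .
  have norm: "of_real (1 / (norm a * Lp_fun_norm M p g) powr (p - 2)) * of_real (norm a powr (p - 2))
      = (of_real (1 / Lp_fun_norm M p g powr (p - 2)) :: 'f)"
    using a by (simp add: powr_mult)
  have "\<not> (AE s in M. smul a (g s) = 0)"
    using False by simp
  then have "sip_fun smul M p f (\<lambda>s. smul a (g s))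
      = of_real (1 / (norm a * Lp_fun_norm M p g) powr (p - 2)) * (of_real (norm a powr (p - 2)) * conjg a *
        set_lebesgue_integral M (nonzero_set M g) (sip_integrand smul p f g))"
    using g by (simp add: sip_fun_def Lp_fun_norm_smul int)
  also have "\<dots> = conjg a * (of_real (1 / Lp_fun_norm M p g powr (p - 2)) *
        set_lebesgue_integral M (nonzero_set M g) (sip_integrand smul p f g))"
    unfolding norm[symmetric] by (simp only: mult_ac)
  finally show ?thesis
    using False by (simp add: sip_fun_def)
qed

text \<open>Hoelder's inequality bounds the integral by \<open>\<parallel>f\<parallel> \<parallel>g\<parallel> powr (p - 1)\<close>, and the normalisation is
  chosen to leave \<open>\<parallel>f\<parallel> \<parallel>g\<parallel>\<close>.\<close>

lemma norm_sip_fun_le: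
  assumes f: "f \<in> Lp_fun M p" and g: "g \<in> Lp_fun M p"
  shows "norm (sip_fun smul M p f g) \<le> Lp_fun_norm M p f * Lp_fun_norm M p g"
proof (cases "AE s in M. g s = 0")
  case True
  then show ?thesis by (simp add: sip_fun_def Lp_fun_norm_nonneg)
next
  case False
  let ?n = "Lp_fun_norm M p g"
  have n: "0 < ?n" using g False by (rule Lp_fun_norm_pos)
  have "norm (set_lebesgue_integral M (nonzero_set M g) (sip_integrand smul p f g))
      \<le> (\<integral>s. norm (indicator (nonzero_set M g) s *\<^sub>R sip_integrand smul p f g s) \<partial>M)"
    unfolding set_lebesgue_integral_def by (rule integral_norm_bound)
  also have "\<dots> \<le> (\<integral>s. norm (f s) * norm (g s) powr (p - 1) \<partial>M)"
  proof (rule integral_mono)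
    show "integrable M (\<lambda>s. norm (indicator (nonzero_set M g) s *\<^sub>R sip_integrand smul p f g s))"
      using set_integrable_sip_integrand[OF f g]
      unfolding set_integrable_def by (rule integrable_norm)
    show "integrable M (\<lambda>s. norm (f s) * norm (g s) powr (p - 1))"
      using f g False by (rule integrable_norm_mult_norm_powr)
  qed (rule norm_sip_integrand_le)
  also have "\<dots> \<le> Lp_fun_norm M p f * ?n powr (p - 1)"
    using f g False by (rule integrable_norm_mult_norm_powr)
  finally have "norm (sip_fun smul M p f g) \<le> 1 / ?n powr (p - 2) * (Lp_fun_norm M p f * ?n powr (p - 1))"
    using False by (simp add: sip_fun_def norm_mult norm_divide divide_right_mono)
  also have "\<dots> = Lp_fun_norm M p f * ?n"
    using n powr_mult_base[of ?n "p - 2"] by (simp add: field_simps)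
  finally show ?thesis .
qed

lemma sip_fun_self:
  assumes g: "g \<in> Lp_fun M p"
  shows "sip_fun smul M p g g = of_real ((Lp_fun_norm M p g)\<^sup>2)"
proof (cases "AE s in M. g s = 0")
  case True
  then have "Lp_fun_norm M p g = Lp_fun_norm M p (\<lambda>_. 0 :: 'x)"
    by (rule Lp_fun_norm_cong_AE)
  then show ?thesis using True by (simp add: sip_fun_def Lp_fun_norm_def)
next
  case False
  let ?n = "Lp_fun_norm M p g"
  have n: "0 < ?n" using g False by (rule Lp_fun_norm_pos)
  have "indicator (nonzero_set M g) s *\<^sub>R sip_integrand smul p g g s = of_real (norm (g s) powr p)"
    if "s \<in> space M" for s
  proof (cases "g s = 0")
    case False
    then show ?thesis
      using that powr_mult_base[of "norm (g s)" "p - 1"]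
      by (simp add: nonzero_set_def sip_integrand_def support_functional_self mult.commute
          flip: of_real_mult)
  qed (simp add: nonzero_set_def)
  then have "set_lebesgue_integral M (nonzero_set M g) (sip_integrand smul p g g)
      = (\<integral>s. of_real (norm (g s) powr p) \<partial>M)"
    unfolding set_lebesgue_integral_def by (intro Bochner_Integration.integral_cong) auto
  also have "\<dots> = of_real (?n powr p)"
    unfolding Lp_fun_norm_powr[OF g] using g
    by (intro integral_bounded_linear[OF bounded_linear_of_real])
      (simp add: Lp_fun_iff_integrable)
  finally have "sip_fun smul M p g g = of_real (?n powr p / ?n powr (p - 2))"
    using False by (simp add: sip_fun_def)
  also have "?n powr p / ?n powr (p - 2) = ?n\<^sup>2"
    using n powr_diff[of ?n p "p - 2"] by (simp add: powr_numeral)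
  finally show ?thesis .
qed

section \<open>Passage to classes\<close>

lemma Lp_rep_class:
  assumes "f \<in> Lp_fun M p"
  shows "Lp_rep (Lp_class M p f) \<in> Lp_fun M p" "AE s in M. Lp_rep (Lp_class M p f) s = f s"
proof -
  have "f \<in> Lp_class M p f"
    using assms by (simp add: Lp_class_def Lp_rel_def)
  then have "Lp_rep (Lp_class M p f) \<in> Lp_class M p f"
    unfolding Lp_rep_def by (rule someI[where P = "\<lambda>h. h \<in> Lp_class M p f"])
  then show "Lp_rep (Lp_class M p f) \<in> Lp_fun M p" "AE s in M. Lp_rep (Lp_class M p f) s = f s"
    by (auto simp: Lp_class_def Lp_rel_def elim: AE_mp)
qed

lemma Lp_rep_in_Lp_fun: "A \<in> Lp M p \<Longrightarrow> Lp_rep A \<in> Lp_fun M p"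
  unfolding Lp_def by (auto elim!: quotientE simp: Lp_rep_class simp flip: Lp_class_def)

lemma Lp_sip_class:
  assumes "f \<in> Lp_fun M p" "g \<in> Lp_fun M p"
  shows "Lp_sip smul M p (Lp_class M p f) (Lp_class M p g) = sip_fun smul M p f g"
  unfolding Lp_sip_def using assms by (intro sip_fun_cong_AE Lp_rep_class)

lemma semi_inner_product_Lp:
  "semi_inner_product_on (Lp M p :: ('s \<Rightarrow> 'x) set set) (Lp_add M p) (Lp_scale smul M p)
    (Lp_norm M p) (Lp_sip smul M p)"
  unfolding semi_inner_product_on_def
proof (intro conjI ballI allI)
  fix A B C :: "('s \<Rightarrow> 'x) set" and a b :: 'f
  assume "A \<in> Lp M p" "B \<in> Lp M p" "C \<in> Lp M p"
  then have *: "Lp_rep A \<in> Lp_fun M p" "Lp_rep B \<in> Lp_fun M p" "Lp_rep C \<in> Lp_fun M p"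
    by (simp_all add: Lp_rep_in_Lp_fun)
  let ?S = "Lp_add M p (Lp_scale smul M p a A) (Lp_scale smul M p b B)"
  have scale: "Lp_rep (Lp_scale smul M p c D) \<in> Lp_fun M p"
      "AE s in M. Lp_rep (Lp_scale smul M p c D) s = smul c (Lp_rep D s)"
    if "Lp_rep D \<in> Lp_fun M p" for c and D :: "('s \<Rightarrow> 'x) set"
    using Lp_rep_class[OF Lp_fun_smul[OF that]] by (simp_all add: Lp_scale_def)
  have S: "Lp_rep ?S \<in> Lp_fun M p"
      "AE s in M. Lp_rep ?S s = Lp_rep (Lp_scale smul M p a A) s + Lp_rep (Lp_scale smul M p b B) s"
    using Lp_rep_class[OF Lp_fun_add[OF scale(1)[OF *(1)] scale(1)[OF *(2)]]]
    by (simp_all add: Lp_add_def)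
  have "AE s in M. Lp_rep ?S s = smul a (Lp_rep A s) + smul b (Lp_rep B s)"
    using S(2) scale(2)[OF *(1), of a] scale(2)[OF *(2), of b] by eventually_elim simp
  then have "sip_fun smul M p (Lp_rep ?S) (Lp_rep C)
      = sip_fun smul M p (\<lambda>s. smul a (Lp_rep A s) + smul b (Lp_rep B s)) (Lp_rep C)"
    using * S(1) by (intro sip_fun_cong_AE Lp_fun_add Lp_fun_smul) auto
  then show "Lp_sip smul M p ?S C = a * Lp_sip smul M p A C + b * Lp_sip smul M p B C"
    using * by (simp add: Lp_sip_def sip_fun_linear)
next
  fix A B :: "('s \<Rightarrow> 'x) set" and a :: 'f
  assume "A \<in> Lp M p" "B \<in> Lp M p"
  then have *: "Lp_rep A \<in> Lp_fun M p" "Lp_rep B \<in> Lp_fun M p"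
    by (simp_all add: Lp_rep_in_Lp_fun)
  have "sip_fun smul M p (Lp_rep A) (Lp_rep (Lp_scale smul M p a B))
      = sip_fun smul M p (Lp_rep A) (\<lambda>s. smul a (Lp_rep B s))"
    unfolding Lp_scale_def using *
    by (intro sip_fun_cong_AE Lp_rep_class Lp_fun_smul) auto
  then show "Lp_sip smul M p A (Lp_scale smul M p a B) = conjg a * Lp_sip smul M p A B"
    using * by (simp add: Lp_sip_def sip_fun_smul_right)
next
  fix A B :: "('s \<Rightarrow> 'x) set"
  assume "A \<in> Lp M p" "B \<in> Lp M p"
  then show "norm (Lp_sip smul M p A B) \<le> Lp_norm M p A * Lp_norm M p B"
    by (simp add: Lp_sip_def Lp_norm_def norm_sip_fun_le Lp_rep_in_Lp_fun)
next
  fix A :: "('s \<Rightarrow> 'x) set"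
  assume "A \<in> Lp M p"
  then show "Lp_sip smul M p A A = of_real ((Lp_norm M p A)\<^sup>2)"
    by (simp add: Lp_sip_def Lp_norm_def sip_fun_self Lp_rep_in_Lp_fun)
qed

end

theorem proposition3p5:
  fixes M :: "'s measure"
    and smul :: "'f::real_or_complex \<Rightarrow> 'x::banach \<Rightarrow> 'x"
    and p :: real
  assumes "complete_measure M"
    and "banach_over smul"
    and "frechet_differentiable_norm smul"
    and "1 < p"
  shows "(\<forall>f\<in>Lp_fun M p. \<forall>g\<in>Lp_fun M p.
           set_integrable M (nonzero_set M g) (sip_integrand smul p f g) \<and>
           Lp_sip smul M p (Lp_class M p f) (Lp_class M p g) = sip_fun smul M p f g) \<and>
         semi_inner_product_on (Lp M p :: ('s \<Rightarrow> 'x) set set) (Lp_add M p) (Lp_scale smul M p)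
           (Lp_norm M p) (Lp_sip smul M p)"
proof -
  interpret frechet_smooth_Lp smul M p
    using assms by (simp add: frechet_smooth_Lp_def frechet_smooth_over_def
        frechet_smooth_over_axioms_def frechet_smooth_Lp_axioms_def)
  show ?thesis
    using set_integrable_sip_integrand Lp_sip_class semi_inner_product_Lp by blast
qed

end
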